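(* Let $\{G_n\}_{n\ge0}$ be a strongly polynomial sequence of graphs. Then the chromatic polynomials $\{\chi(G_n,x)\}_{n\ge 0}$ and the characteristic polynomials $\{\psi(G_n,x)\}_{n\ge0}$ (polynomials in $x$, indexed by $n$) are both two-level polynomials of infinite depth.
   Context: Graphs are finite and simple. $\hom(F,G)$ denotes the number of graph homomorphisms (edge-preserving vertex maps) from $F$ to $G$. A sequence $\{G_n\}_{n\ge0}$ of graphs is strongly polynomial if for every fixed graph $F$ there is a polynomial $p_F$ such that $\hom(F,G_n)=p_F(n)$ for all $n\ge 0$. The chromatic polynomial $\chi(G,x)$ is the unique polynomial whose value at each natural number $m$ is the number of proper $m$-colorings of $G$. The characteristic polynomial $\psi(G,x)$ is the characteristic polynomial of the adjacency matrix of $G$. A numerical polynomial is $g\in\mathbb Q[x]$ with $g(q)\in\mathbb Z$ for all $q\in\mathbb Z$. Two-level polynomial: let $g$ be an eventually nonnegative numerical polynomial, $S=\{q\in\mathbb N: g(q)\ge0\}$, and $e:S\to\mathbb N\cup\{-1,\infty\}$. A sequence of polynomials $\{f_q(x)\}_{q\in S}$, with $f_q$ of degree $g(q)$, is a two-level polynomial of degree function $g$ and depth function $e$ if, writing $f_q(x)=\sum_{r=0}^\infty c_r(q)x^{g(q)-r}$ with $c_r(q)=0$ for $r>g(q)$, there exist polynomials $\{\varphi_r(q)\}_{r\ge0}$ such that $c_r(q)=\varphi_r(q)$ for every $q\in S$ and every $r\le e(q)$. (For $q\in\mathbb N\setminus S$ one sets $f_q=0$, $e(q)=-1$.) Infinite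 depth means $e(q)=\infty$ for all $q\in S$. In the claim the index $n$ plays the role of $q$. *)

theory Defs
  imports
    "Graph_Theory.Pair_Digraph"
    "Jordan_Normal_Form.Char_Poly"
    "HOL-Library.FuncSet"
    "HOL-Library.Extended_Real"
begin

text \<open>
  A finite simple graph is a \<^locale>\<open>pair_graph\<close>: a finite vertex set with a symmetric,
  irreflexive arc relation, so that an edge between \<open>u\<close> and \<open>v\<close> is the pair of arcs
  \<open>(u, v)\<close> and \<open>(v, u)\<close>. The graph without vertices is included.
\<close>

text \<open>Extensional function spaces make each vertex map on the vertex set count exactly once.\<close>

definition graph_homs :: "'a pair_pre_digraph \<Rightarrow> 'b pair_pre_digraph \<Rightarrow> ('a \<Rightarrow> 'b) set" where
  "graph_homs F G =
     {h \<in> pverts F \<rightarrow>\<^sub>E pverts G. \<forall>(u, v) \<in> parcs F. (h u, h v) \<in> parcs G}"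

definition hom_count :: "'a pair_pre_digraph \<Rightarrow> 'b pair_pre_digraph \<Rightarrow> nat" where
  "hom_count F G = card (graph_homs F G)"

text \<open>
  The test graphs \<open>F\<close> have natural numbers as vertices; every finite graph is isomorphic to
  such a graph, and \<^const>\<open>hom_count\<close> is invariant under isomorphism.
\<close>

definition strongly_polynomial :: "(nat \<Rightarrow> 'a pair_pre_digraph) \<Rightarrow> bool" where
  "strongly_polynomial G \<longleftrightarrow>
     (\<forall>F :: nat pair_pre_digraph. pair_graph F \<longrightarrow>
        (\<exists>p :: rat poly. \<forall>n. of_nat (hom_count F (G n)) = poly p (of_nat n)))"

definition proper_colorings :: "nat \<Rightarrow> 'a pair_pre_digraph \<Rightarrow> ('a \<Rightarrow> nat) set" where
  "proper_colorings m G =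
     {c \<in> pverts G \<rightarrow>\<^sub>E {..<m}. \<forall>(u, v) \<in> parcs G. c u \<noteq> c v}"

definition chromatic_poly :: "'a pair_pre_digraph \<Rightarrow> rat poly" where
  "chromatic_poly G =
     (THE p. \<forall>m :: nat. poly p (of_nat m) = of_nat (card (proper_colorings m G)))"

definition adjacency_mat :: "'a list \<Rightarrow> 'a pair_pre_digraph \<Rightarrow> rat mat" where
  "adjacency_mat vs G =
     mat (length vs) (length vs) (\<lambda>(i, j). if (vs ! i, vs ! j) \<in> parcs G then 1 else 0)"

text \<open>
  The characteristic polynomial is that of the adjacency matrix with respect to an arbitrary
  enumeration of the vertices; a different enumeration conjugates the matrix by a permutation
  matrix.
\<close>

definition graph_char_poly :: "'a pair_pre_digraph \<Rightarrow> rat poly" where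
  "graph_char_poly G =
     char_poly (adjacency_mat (SOME vs. distinct vs \<and> set vs = pverts G) G)"

definition numerical_poly :: "rat poly \<Rightarrow> bool" where
  "numerical_poly g \<longleftrightarrow> (\<forall>q :: int. poly g (of_int q) \<in> \<int>)"

definition level_set :: "rat poly \<Rightarrow> nat set" where
  "level_set g = {q. 0 \<le> poly g (of_nat q)}"

text \<open>The coefficient of \<open>x ^ (d - r)\<close> in \<open>p\<close>, which is zero when \<open>d - r\<close> is negative.\<close>

definition codeg_coeff :: "nat \<Rightarrow> rat poly \<Rightarrow> nat \<Rightarrow> rat" where
  "codeg_coeff d p r = (if r \<le> d then coeff p (d - r) else 0)"

text \<open>
  Depths lie in the naturals extended by \<open>-1\<close> and \<open>\<infinity>\<close>. Sequences are total
  functions on the naturals, so the convention for indices outside \<^term>\<open>level_set g\<close> is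
  part of the definition. On \<^term>\<open>level_set g\<close> the member \<open>f q\<close> is nonzero also when
  \<open>g\<close> vanishes at \<open>q\<close>, as the zero polynomial does not have degree 0 in the usual sense
  even though \<^const>\<open>degree\<close> returns 0 for it.
\<close>

definition two_level_poly :: "rat poly \<Rightarrow> (nat \<Rightarrow> ereal) \<Rightarrow> (nat \<Rightarrow> rat poly) \<Rightarrow> bool" where
  "two_level_poly g e f \<longleftrightarrow>
     numerical_poly g \<and>
     (\<forall>\<^sub>F q in sequentially. 0 \<le> poly g (of_nat q)) \<and>
     (\<forall>q. e q \<in> insert (- 1) (range ereal_of_enat)) \<and>
     (\<forall>q. q \<notin> level_set g \<longrightarrow> f q = 0 \<and> e q = - 1) \<and>
     (\<forall>q \<in> level_set g. f q \<noteq> 0 \<and> of_nat (degree (f q)) = poly g (of_nat q)) \<and>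
     (\<exists>\<phi> :: nat \<Rightarrow> rat poly. \<forall>q \<in> level_set g. \<forall>r :: nat.
        ereal (real r) \<le> e q \<longrightarrow>
        codeg_coeff (degree (f q)) (f q) r = poly (\<phi> r) (of_nat q))"

definition two_level_poly_infinite_depth :: "(nat \<Rightarrow> rat poly) \<Rightarrow> bool" where
  "two_level_poly_infinite_depth f \<longleftrightarrow>
     (\<exists>g e. two_level_poly g e f \<and> (\<forall>q \<in> level_set g. e q = \<infinity>))"

end

(*
  In both polynomials the coefficient of x^(|V| - r) is a sum, over vertex sets U of bounded size,
  of a weight that depends only on the isomorphism type of the graph induced on U.
  For the chromatic polynomial, inclusion-exclusion over the arc relations S violated by a colouring
  gives the exponent |V| - |U| + c, where U is the set of endpoints of S and c the number of its
  components; each component has at least two vertices, so codegree r forces |U| <= 2r. Since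
  1 - [c u = c v] is idempotent, arcs may be used in place of edges.
  For the characteristic polynomial, U is the support of a permutation in the Leibniz expansion of
  the determinant, and codegree r means |U| = r.
  Such a sum is a linear combination of numbers of induced embeddings of labelled graphs, and these
  are linear combinations of homomorphism numbers.
*)
theory Submission
  imports Defs
begin

section \<open>Counting embeddings by homomorphisms\<close>

text \<open>For fixed r, neither the sizes of U nor the labelled patterns on them depend on n; so a
  coefficient is a fixed finite combination of counts, each of which is polynomial in n by itself.
  Passing from induced embeddings to homomorphisms takes two inclusion-exclusions: a forbidden arc
  is traded for a required one, a disequality for an identification of its two ends. Together they
  produce patterns with loops or one-way arcs, so the counting is set up for arbitrary relations
  instead of graphs. The depth is infinite because the coefficient formulas are exact for every n,
  including r > |V|, where both sides vanish. The degree function is |V|, that is hom(K_1, G_n); it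
  is nonnegative, so every index lies in the level set. Two obstacles remain. The matrix is indexed
  by list positions, under an enumeration chosen separately for each n; this calls for isomorphic
  copies of the graphs on initial segments of the naturals. And a numerical polynomial is integral
  at negative integers too, where no graph gives information; a common denominator settles
  that.\<close>

definition polynomial_seq :: "(nat \<Rightarrow> rat) \<Rightarrow> bool" where
  "polynomial_seq f \<longleftrightarrow> (\<exists>p. \<forall>n. f n = poly p (of_nat n))"

lemma polynomial_seq_const [intro]: "polynomial_seq (\<lambda>_. c)"
  unfolding polynomial_seq_def by (rule exI[of _ "[:c:]"]) simp

lemma polynomial_seq_add [intro]:
  "polynomial_seq f \<Longrightarrow> polynomial_seq g \<Longrightarrow> polynomial_seq (\<lambda>n. f n + g n)"
  unfolding polynomial_seq_def by (metis poly_add)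

lemma polynomial_seq_diff [intro]:
  "polynomial_seq f \<Longrightarrow> polynomial_seq g \<Longrightarrow> polynomial_seq (\<lambda>n. f n - g n)"
  unfolding polynomial_seq_def by (metis poly_diff)

lemma polynomial_seq_cmult [intro]: "polynomial_seq f \<Longrightarrow> polynomial_seq (\<lambda>n. c * f n)"
  unfolding polynomial_seq_def by (metis poly_smult)

lemma polynomial_seq_sum [intro]:
  "(\<And>i. i \<in> I \<Longrightarrow> polynomial_seq (f i)) \<Longrightarrow> polynomial_seq (\<lambda>n. \<Sum>i\<in>I. f i n)"
  by (induction I rule: infinite_finite_induct) auto

lemma pair_graphD:
  assumes "pair_graph G"
  shows "finite (pverts G)" and "finite (parcs G)" and "parcs G \<subseteq> pverts G \<times> pverts G"
    and "\<And>u v. (u, v) \<in> parcs G \<Longrightarrow> (v, u) \<in> parcs G" and "\<And>u. (u, u) \<notin> parcs G"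
proof -
  interpret pair_graph G by fact
  show "finite (pverts G)" by (rule pair_finite_verts)
  show "finite (parcs G)" by (rule pair_finite_arcs)
  show "parcs G \<subseteq> pverts G \<times> pverts G" using in_arcsD1 in_arcsD2 by auto
  show "(v, u) \<in> parcs G" if "(u, v) \<in> parcs G" for u v
    using that pair_sym_arcs by (auto simp: symmetric_def sym_def)
  show "(u, u) \<notin> parcs G" for u using no_loops by fastforce
qed

lemma pair_graphI:
  assumes "finite (pverts G)" and "parcs G \<subseteq> pverts G \<times> pverts G"
    and "\<And>u v. (u, v) \<in> parcs G \<Longrightarrow> (v, u) \<in> parcs G" and "\<And>u. (u, u) \<notin> parcs G"
  shows "pair_graph G"
proof unfold_locales
  show "finite (parcs G)" using assms(1,2) finite_subset by blast
  show "symmetric G" using assms(3) by (auto simp: symmetric_def sym_def)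
qed (use assms in auto)

text \<open>One family for the whole passage: \<open>D\<close> and \<open>N\<close> empty gives
  homomorphisms, while \<open>D\<close> all off-diagonal pairs and \<open>N\<close> the complement
  of \<open>S\<close> gives induced embeddings of the pattern \<open>S\<close>.\<close>

definition constrained_maps ::
  "nat set \<Rightarrow> (nat \<times> nat) set \<Rightarrow> (nat \<times> nat) set \<Rightarrow> (nat \<times> nat) set \<Rightarrow>
    'a pair_pre_digraph \<Rightarrow> (nat \<Rightarrow> 'a) set" where
  "constrained_maps I S D N G =
     {h \<in> I \<rightarrow>\<^sub>E pverts G. (\<forall>(i, j)\<in>S. (h i, h j) \<in> parcs G) \<and> (\<forall>(i, j)\<in>D. h i \<noteq> h j) \<and>
        (\<forall>(i, j)\<in>N. (h i, h j) \<notin> parcs G)}"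

lemma finite_constrained_maps:
  "finite I \<Longrightarrow> finite (pverts G) \<Longrightarrow> finite (constrained_maps I S D N G)"
  unfolding constrained_maps_def by (simp add: finite_PiE)

definition pulled_arcs :: "'b set \<Rightarrow> ('b \<Rightarrow> 'c) \<Rightarrow> ('c \<times> 'c) set \<Rightarrow> ('b \<times> 'b) set" where
  "pulled_arcs I h A = {(i, j) \<in> I \<times> I. (h i, h j) \<in> A}"

locale strongly_polynomial_graphs =
  fixes G :: "nat \<Rightarrow> 'a pair_pre_digraph"
  assumes graph: "pair_graph (G n)"
    and strong: "strongly_polynomial G"
begin

text \<open>A loop in \<open>S\<close> admits no map, since \<open>G n\<close> is loopless.
  Otherwise the symmetric closure of \<open>S\<close> is a graph that has the same maps as
  \<open>S\<close>, because the arcs of \<open>G n\<close> are symmetric.\<close>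

lemma polynomial_seq_arc_maps:
  assumes "finite I" and "S \<subseteq> I \<times> I"
  shows "polynomial_seq (\<lambda>n. of_nat (card (constrained_maps I S {} {} (G n))))"
proof (cases "\<exists>i. (i, i) \<in> S")
  case True
  then have "constrained_maps I S {} {} (G n) = {}" for n
    using pair_graphD(5)[OF graph[of n]] by (fastforce simp: constrained_maps_def)
  then show ?thesis by auto
next
  case False
  define F where "F = \<lparr>pverts = I, parcs = S \<union> S\<inverse>\<rparr>"
  have "pair_graph F"
    by (rule pair_graphI) (use assms False in \<open>auto simp: F_def\<close>)
  then obtain p where p: "\<And>n. of_nat (hom_count F (G n)) = poly p (of_nat n :: rat)"
    using strong unfolding strongly_polynomial_def by blast
  have "constrained_maps I S {} {} (G n) = graph_homs F (G n)" for n
    using pair_graphD(4)[OF graph[of n]]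
    by (fastforce simp: constrained_maps_def graph_homs_def F_def)
  then show ?thesis using p by (auto simp: polynomial_seq_def hom_count_def)
qed

text \<open>
  A disequality is removed by subtracting the maps that identify its two ends; those maps
  factor through the quotient of the pattern.
\<close>

lemma polynomial_seq_distinct_arc_maps:
  assumes "finite I" and "S \<subseteq> I \<times> I" and "finite D" and "D \<subseteq> I \<times> I"
  shows "polynomial_seq (\<lambda>n. of_nat (card (constrained_maps I S D {} (G n))))"
  using assms
proof (induction "card D" arbitrary: I S D rule: less_induct)
  case less
  show ?case
  proof (cases "D = {}")
    case True
    then show ?thesis using polynomial_seq_arc_maps less.prems by simp
  next
    case False
    then obtain i j where ij: "(i, j) \<in> D" by auto
    define D' where "D' = D - {(i, j)}"
    have D: "D = insert (i, j) D'" using ij by (auto simp: D'_def)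
    have D': "card D' < card D" "finite D'" "D' \<subseteq> I \<times> I"
      using ij less.prems card_Diff1_less[of D "(i, j)"] by (auto simp: D'_def)
    have IJ: "i \<in> I" "j \<in> I" using ij less.prems by auto
    show ?thesis
    \<comment> \<open>Earlier identifications may have collapsed a disequality to a diagonal pair,
      which no map satisfies.\<close>
    proof (cases "i = j")
      case True
      then have "constrained_maps I S D {} (G n) = {}" for n
        using ij by (auto simp: constrained_maps_def)
      then show ?thesis by auto
    next
      case False
      \<comment> \<open>\<open>q\<close> retracts \<open>I\<close> onto \<open>I - {j}\<close>. Maps
        with \<open>h i = h j\<close> are exactly those of the form h' o q, so they correspond to
        the maps of the pattern pushed forward along \<open>q\<close>.\<close>
      define q where "q = (\<lambda>x. if x = j then i else x)"
      define I' where "I' = I - {j}"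
      define M where "M n = constrained_maps I S D' {} (G n)" for n
      define Q where "Q n = constrained_maps I' (map_prod q q ` S) (map_prod q q ` D') {} (G n)" for n
      have q: "q x \<in> I'" if "x \<in> I" for x using that IJ False by (auto simp: q_def I'_def)
      have "card (map_prod q q ` D') < card D"
        \<comment> \<open>Pushing forward may merge disequalities but never adds any, so the measure
          drops although \<open>I\<close> and \<open>S\<close> change.\<close>
        using D' card_image_le[of D' "map_prod q q"] by linarith
      then have polyQ: "polynomial_seq (\<lambda>n. of_nat (card (Q n)))"
        unfolding Q_def
      proof (rule less.hyps)
        show "map_prod q q ` S \<subseteq> I' \<times> I'" using less.prems q by fastforce
        show "map_prod q q ` D' \<subseteq> I' \<times> I'" using D' q by fastforce
      qed (use less.prems D' in \<open>auto simp: I'_def\<close>)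
      have polyM: "polynomial_seq (\<lambda>n. of_nat (card (M n)))"
        unfolding M_def by (rule less.hyps) (use less.prems D' in auto)
      have "of_nat (card (constrained_maps I S D {} (G n))) =
          (of_nat (card (M n)) - of_nat (card (Q n)) :: rat)" for n
      proof -
        have finM: "finite (M n)" unfolding M_def
          by (intro finite_constrained_maps less.prems pair_graphD(1) graph)
        have "bij_betw (\<lambda>h. restrict h I') {h \<in> M n. h i = h j} (Q n)"
        proof (rule bij_betw_byWitness[where f' = "\<lambda>h. \<lambda>x\<in>I. h (q x)"])
          show "\<forall>h\<in>{h \<in> M n. h i = h j}. (\<lambda>x\<in>I. restrict h I' (q x)) = h"
          proof safe
            fix h assume h: "h \<in> M n" "h i = h j"
            show "(\<lambda>x\<in>I. restrict h I' (q x)) = h"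
            proof
              fix x show "(\<lambda>x\<in>I. restrict h I' (q x)) x = h x"
                using h q[of x] by (auto simp: M_def constrained_maps_def q_def)
            qed
          qed
          show "\<forall>h\<in>Q n. restrict (\<lambda>x\<in>I. h (q x)) I' = h"
          proof
            fix h assume h: "h \<in> Q n"
            then have "h \<in> extensional I'" by (simp add: Q_def constrained_maps_def PiE_iff)
            then show "restrict (\<lambda>x\<in>I. h (q x)) I' = h"
              by (auto simp: fun_eq_iff restrict_def extensional_def I'_def q_def)
          qed
          show "(\<lambda>h. restrict h I') ` {h \<in> M n. h i = h j} \<subseteq> Q n"
          proof safe
            fix h assume h: "h \<in> M n" "h i = h j"
            define r where "r = restrict h I'"
            have hq: "r (q x) = h x" if "x \<in> I" for x
              using h q[OF that] by (auto simp: q_def r_def)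
            have "(r (q x), r (q y)) \<in> parcs (G n)" if "(x, y) \<in> S" for x y
            proof -
              have "x \<in> I" "y \<in> I" using that less.prems(2) by auto
              then show ?thesis using that h(1)
                by (simp only: hq) (auto simp: M_def constrained_maps_def)
            qed
            moreover have "r (q x) \<noteq> r (q y)" if "(x, y) \<in> D'" for x y
            proof -
              have "x \<in> I" "y \<in> I" using that D'(3) by auto
              then show ?thesis using that h(1)
                by (simp only: hq) (auto simp: M_def constrained_maps_def)
            qed
            moreover have "r \<in> I' \<rightarrow>\<^sub>E pverts (G n)"
              using h(1) by (auto simp: M_def constrained_maps_def I'_def r_def)
            ultimately have "r \<in> Q n"
              unfolding Q_def constrained_maps_def by auto
            then show "restrict h I' \<in> Q n" by (simp add: r_def)
          qed
          show "(\<lambda>h. \<lambda>x\<in>I. h (q x)) ` Q n \<subseteq> {h \<in> M n. h i = h j}"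
          proof safe
            fix h assume h: "h \<in> Q n"
            have "(h (q x), h (q y)) \<in> parcs (G n)" if "(x, y) \<in> S" for x y
              using h that by (force simp: Q_def constrained_maps_def)
            moreover have "h (q x) \<noteq> h (q y)" if "(x, y) \<in> D'" for x y
              using h that by (force simp: Q_def constrained_maps_def)
            moreover have "h (q x) \<in> pverts (G n)" if "x \<in> I" for x
              using h q[OF that] by (auto simp: Q_def constrained_maps_def)
            ultimately show "(\<lambda>x\<in>I. h (q x)) \<in> M n"
              using less.prems(2) D'(3) unfolding M_def constrained_maps_def by auto
            show "(\<lambda>x\<in>I. h (q x)) i = (\<lambda>x\<in>I. h (q x)) j"
              using IJ by (simp add: q_def)
          qed
        qed
        then have "card {h \<in> M n. h i = h j} = card (Q n)" by (rule bij_betw_same_card)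
        moreover have "constrained_maps I S D {} (G n) = M n - {h \<in> M n. h i = h j}"
          by (auto simp: M_def constrained_maps_def D)
        moreover have "card {h \<in> M n. h i = h j} \<le> card (M n)"
          using finM by (intro card_mono) auto
        ultimately show ?thesis
          using finM by (simp add: card_Diff_subset of_nat_diff)
      qed
      then show ?thesis using polyM polyQ by auto
    qed
  qed
qed

text \<open>Maps that avoid an arc at \<open>e\<close> are all maps minus those with an arc at
  \<open>e\<close>. The subtracted term has one more required arc, hence the induction on
  \<open>N\<close> with \<open>S\<close> arbitrary.\<close>

lemma polynomial_seq_constrained_maps:
  assumes "finite I" and "S \<subseteq> I \<times> I" and "D \<subseteq> I \<times> I" and "N \<subseteq> I \<times> I"
  shows "polynomial_seq (\<lambda>n. of_nat (card (constrained_maps I S D N (G n))))"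
proof -
  have "finite N" "finite D" using assms finite_subset by blast+
  then show ?thesis using assms
  proof (induction N arbitrary: S rule: finite_induct)
    case empty
    then show ?case using polynomial_seq_distinct_arc_maps by blast
  next
    case (insert e N)
    obtain i j where e: "e = (i, j)" by fastforce
    have "of_nat (card (constrained_maps I S D (insert e N) (G n))) =
        (of_nat (card (constrained_maps I S D N (G n))) -
         of_nat (card (constrained_maps I (insert e S) D N (G n))) :: rat)" for n
    proof -
      let ?M = "constrained_maps I S D N (G n)" and ?A = "constrained_maps I (insert e S) D N (G n)"
      have fin: "finite ?M" "finite ?A"
        by (intro finite_constrained_maps insert.prems pair_graphD(1) graph)+
      have sub: "?A \<subseteq> ?M" by (auto simp: constrained_maps_def)
      have "constrained_maps I S D (insert e N) (G n) = ?M - ?A"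
        by (auto simp: constrained_maps_def e)
      then show ?thesis using fin sub by (simp add: card_Diff_subset of_nat_diff card_mono)
    qed
    then show ?case using insert by auto
  qed
qed

text \<open>Injections are grouped by the pattern \<open>R\<close> that they induce on
  \<open>I\<close>. The range \<open>Pow (I \<times> I)\<close> of patterns is finite and the same
  for all n, and the weight is constant on each group.\<close>

lemma polynomial_seq_sum_injections:
  fixes w :: "(nat \<times> nat) set \<Rightarrow> rat"
  assumes "finite I"
  shows "polynomial_seq (\<lambda>n. \<Sum>h | h \<in> I \<rightarrow>\<^sub>E pverts (G n) \<and> inj_on h I.
           w (pulled_arcs I h (parcs (G n))))"
proof -
  have "(\<Sum>h | h \<in> I \<rightarrow>\<^sub>E pverts (G n) \<and> inj_on h I. w (pulled_arcs I h (parcs (G n)))) =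
      (\<Sum>R\<in>Pow (I \<times> I). w R *
        of_nat (card (constrained_maps I R {(i, j) \<in> I \<times> I. i \<noteq> j} (I \<times> I - R) (G n))))" (is "?l n = ?r n") for n
  proof -
    let ?H = "{h. h \<in> I \<rightarrow>\<^sub>E pverts (G n) \<and> inj_on h I}"
    let ?f = "\<lambda>h. pulled_arcs I h (parcs (G n))"
    have "finite ?H" using assms pair_graphD(1)[OF graph] by (simp add: finite_PiE)
    moreover have "finite (Pow (I \<times> I))" "?f ` ?H \<subseteq> Pow (I \<times> I)"
      using assms by (auto simp: pulled_arcs_def)
    ultimately have "?l n = (\<Sum>R\<in>Pow (I \<times> I). \<Sum>h | h \<in> ?H \<and> ?f h = R. w (?f h))"
      by (intro sum.group[symmetric])
    also have "\<dots> = (\<Sum>R\<in>Pow (I \<times> I). w R * of_nat (card {h. h \<in> ?H \<and> ?f h = R}))"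
      by (intro sum.cong) auto
    also have "\<dots> = ?r n"
    proof (intro sum.cong refl arg_cong2[where f = "(*)"] arg_cong[where f = of_nat] arg_cong[where f = card])
      fix R assume "R \<in> Pow (I \<times> I)"
      then have R: "R \<subseteq> I \<times> I" by simp
      have f_eq: "?f h = R \<longleftrightarrow> (\<forall>(i, j)\<in>R. (h i, h j) \<in> parcs (G n)) \<and>
          (\<forall>(i, j)\<in>I \<times> I - R. (h i, h j) \<notin> parcs (G n))" for h
        using R by (auto simp: pulled_arcs_def)
      have inj_eq: "inj_on h I \<longleftrightarrow> (\<forall>(i, j)\<in>{(i, j) \<in> I \<times> I. i \<noteq> j}. h i \<noteq> h j)" for h
        by (auto simp: inj_on_def)
      show "{h. h \<in> ?H \<and> ?f h = R} =
        constrained_maps I R {(i, j) \<in> I \<times> I. i \<noteq> j} (I \<times> I - R) (G n)"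
        by (rule Set.set_eqI) (unfold constrained_maps_def mem_Collect_eq f_eq inj_eq, blast)
    qed
    finally show ?thesis .
  qed
  moreover have "polynomial_seq (\<lambda>n. ?r n)"
    by (intro polynomial_seq_sum polynomial_seq_cmult polynomial_seq_constrained_maps assms) auto
  ultimately show ?thesis by simp
qed

text \<open>
  Averaging over the enumerations of a \<open>k\<close>-subset replaces isomorphism types by labelled
  patterns on \<open>{..<k}\<close>.
\<close>

lemma polynomial_seq_sum_subsets:
  fixes w :: "(nat \<times> nat) set \<Rightarrow> rat" and W :: "nat \<Rightarrow> 'a set \<Rightarrow> rat"
  assumes W: "\<And>n h. h \<in> {..<k} \<rightarrow>\<^sub>E pverts (G n) \<Longrightarrow> inj_on h {..<k} \<Longrightarrow>
      W n (h ` {..<k}) = w (pulled_arcs {..<k} h (parcs (G n)))"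
  shows "polynomial_seq (\<lambda>n. \<Sum>U | U \<subseteq> pverts (G n) \<and> card U = k. W n U)"
proof -
  have "(\<Sum>U | U \<subseteq> pverts (G n) \<and> card U = k. W n U) = 1 / fact k *
     (\<Sum>h | h \<in> {..<k} \<rightarrow>\<^sub>E pverts (G n) \<and> inj_on h {..<k}.
        w (pulled_arcs {..<k} h (parcs (G n))))" (is "?l = _ * ?r") for n
  proof -
    let ?H = "{h. h \<in> {..<k} \<rightarrow>\<^sub>E pverts (G n) \<and> inj_on h {..<k}}"
    let ?T = "{U. U \<subseteq> pverts (G n) \<and> card U = k}"
    have fV: "finite (pverts (G n))" by (rule pair_graphD(1)[OF graph])
    have fH: "finite ?H" using fV by (simp add: finite_PiE)
    have fT: "finite ?T" using fV by simp
    have sub: "(\<lambda>h. h ` {..<k}) ` ?H \<subseteq> ?T"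
    proof (rule image_subsetI)
      fix h assume h: "h \<in> ?H"
      then have "h ` {..<k} \<subseteq> pverts (G n)" by blast
      moreover have "card (h ` {..<k}) = k" using h by (simp add: card_image)
      ultimately show "h ` {..<k} \<in> ?T" by blast
    qed
    have "?r = (\<Sum>h\<in>?H. W n (h ` {..<k}))" using W by (intro sum.cong) simp_all
    also have "\<dots> = (\<Sum>U\<in>?T. \<Sum>h | h \<in> ?H \<and> h ` {..<k} = U. W n (h ` {..<k}))"
      by (rule sum.group[OF fH fT sub, symmetric])
    also have "\<dots> = (\<Sum>U\<in>?T. fact k * W n U)"
    proof (rule sum.cong)
      fix U assume U: "U \<in> ?T"
      then have fU: "finite U" using fV finite_subset by blast
      have eq: "{h. h \<in> ?H \<and> h ` {..<k} = U} = {h \<in> {..<k} \<rightarrow>\<^sub>E U. inj_on h {..<k}}"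
        (is "?L = ?R")
      proof
        show "?L \<subseteq> ?R" by blast
        show "?R \<subseteq> ?L"
        proof
          fix h assume h: "h \<in> ?R"
          then have "h ` {..<k} \<subseteq> U" by blast
          moreover have "card (h ` {..<k}) = card U" using U h by (simp add: card_image)
          ultimately have "h ` {..<k} = U" using fU by (simp add: card_subset_eq)
          moreover have "h \<in> {..<k} \<rightarrow>\<^sub>E pverts (G n)" using h U by blast
          ultimately show "h \<in> ?L" using h by blast
        qed
      qed
      \<comment> \<open>A set of size k has \<open>fact k\<close> injective labellings by
        \<open>{..<k}\<close>; this is the factor divided out at the start.\<close>
      have card: "card {h \<in> {..<k} \<rightarrow>\<^sub>E U. inj_on h {..<k}} = fact k"
        using U fU card_inj_on_subset_funcset[of "{..<k}" U "{..<k}"] by (simp add: fact_prod_rev)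
      have "(\<Sum>h | h \<in> ?H \<and> h ` {..<k} = U. W n (h ` {..<k})) =
          (\<Sum>h | h \<in> ?H \<and> h ` {..<k} = U. W n U)"
        by (intro sum.cong) auto
      also have "\<dots> = of_nat (card {h. h \<in> ?H \<and> h ` {..<k} = U}) * W n U"
        by (rule sum_constant)
      finally show "(\<Sum>h | h \<in> ?H \<and> h ` {..<k} = U. W n (h ` {..<k})) = fact k * W n U"
        by (simp only: eq card of_nat_fact)
    qed simp
    finally have "?r = fact k * ?l" by (simp add: sum_distrib_left)
    then show ?thesis by simp
  qed
  moreover have "polynomial_seq (\<lambda>n. 1 / fact k *
     (\<Sum>h | h \<in> {..<k} \<rightarrow>\<^sub>E pverts (G n) \<and> inj_on h {..<k}.
        w (pulled_arcs {..<k} h (parcs (G n)))))"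
    by (intro polynomial_seq_cmult polynomial_seq_sum_injections) simp
  ultimately show ?thesis by simp
qed

end

section \<open>Inclusion-exclusion for the chromatic polynomial\<close>

text \<open>Components of the graph spanned by \<open>S\<close>, without isolated vertices. The
  transitive closure of the symmetrised relation is already reflexive on \<open>Field S\<close>, and
  unlike the reflexive-transitive closure it relates nothing outside.\<close>

definition arc_components :: "('a \<times> 'a) set \<Rightarrow> nat" where
  "arc_components S = card (Field S // (S \<union> S\<inverse>)\<^sup>+)"

text \<open>Colourings that violate every arc of \<open>S\<close>. The domain is a parameter because
  both \<open>Field S\<close> and the whole vertex set occur.\<close>

definition constant_maps :: "'a set \<Rightarrow> ('a \<times> 'a) set \<Rightarrow> nat \<Rightarrow> ('a \<Rightarrow> nat) set" where
  "constant_maps U S m = {c \<in> U \<rightarrow>\<^sub>E {..<m}. \<forall>(u, v)\<in>S. c u = c v}"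

lemma equiv_arc_closure: "equiv (Field S) ((S \<union> S\<inverse>)\<^sup>+)"
proof (rule equivI)
  have F: "Field (S \<union> S\<inverse>) = Field S" by (auto simp: Field_def)
  show "(S \<union> S\<inverse>)\<^sup>+ \<subseteq> Field S \<times> Field S"
    using trancl_subset_Field2[of "S \<union> S\<inverse>"] F by simp
  show "sym ((S \<union> S\<inverse>)\<^sup>+)" by (intro sym_trancl symI) auto
  show "trans ((S \<union> S\<inverse>)\<^sup>+)" by (rule trans_trancl)
  show "refl_on (Field S) ((S \<union> S\<inverse>)\<^sup>+)"
  proof (rule refl_onI)
    fix x assume "x \<in> Field S"
    then obtain y where "(x, y) \<in> S \<union> S\<inverse>" by (auto simp: Field_def)
    moreover from this have "(y, x) \<in> S \<union> S\<inverse>" by auto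
    ultimately show "(x, x) \<in> (S \<union> S\<inverse>)\<^sup>+" by (meson trancl.simps)
  qed
qed

lemma arc_closure_constant:
  assumes "\<forall>(u, v)\<in>S. c u = c v" and "(x, y) \<in> (S \<union> S\<inverse>)\<^sup>+"
  shows "c x = c y"
  using assms(2) by (induction rule: trancl_induct) (use assms(1) in auto)

text \<open>A map constant along arcs is constant on components, so it is the same as a free choice
  of one colour per class of the quotient.\<close>

lemma card_constant_maps_Field:
  assumes "finite (Field S)"
  shows "card (constant_maps (Field S) S m) = m ^ arc_components S"
proof -
  define E where "E = (S \<union> S\<inverse>)\<^sup>+"
  define Q where "Q = Field S // E"
  have eq: "equiv (Field S) E" unfolding E_def by (rule equiv_arc_closure)
  have clQ: "E `` {x} \<in> Q" if "x \<in> Field S" for x using that by (simp add: Q_def quotientI)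
  have finQ: "finite Q"
    unfolding Q_def by (rule finite_quotient[OF assms]) (use eq in \<open>auto simp: equiv_def\<close>)
  have SE: "S \<subseteq> E" by (auto simp: E_def)
  have Scl: "E `` {x} = E `` {y}" if "(x, y) \<in> S" for x y
    using equiv_class_eq[OF eq] that SE by blast
  have "bij_betw (\<lambda>g. \<lambda>x\<in>Field S. g (E `` {x})) (Q \<rightarrow>\<^sub>E {..<m}) (constant_maps (Field S) S m)"
  proof (rule bij_betw_imageI)
    show "inj_on (\<lambda>g. \<lambda>x\<in>Field S. g (E `` {x})) (Q \<rightarrow>\<^sub>E {..<m})"
    proof (rule inj_onI)
      fix g g' assume g: "g \<in> Q \<rightarrow>\<^sub>E {..<m}" "g' \<in> Q \<rightarrow>\<^sub>E {..<m}"
        and eq': "(\<lambda>x\<in>Field S. g (E `` {x})) = (\<lambda>x\<in>Field S. g' (E `` {x}))"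
      show "g = g'"
      proof (rule PiE_ext[OF g])
        fix X assume "X \<in> Q"
        then obtain x where "x \<in> Field S" "X = E `` {x}" unfolding Q_def by (rule quotientE)
        then show "g X = g' X" using fun_cong[OF eq', of x] by simp
      qed
    qed
    show "(\<lambda>g. \<lambda>x\<in>Field S. g (E `` {x})) ` (Q \<rightarrow>\<^sub>E {..<m}) = constant_maps (Field S) S m"
    proof (intro equalityI subsetI)
      fix c assume "c \<in> (\<lambda>g. \<lambda>x\<in>Field S. g (E `` {x})) ` (Q \<rightarrow>\<^sub>E {..<m})"
      then obtain g where g: "g \<in> Q \<rightarrow>\<^sub>E {..<m}" and c: "c = (\<lambda>x\<in>Field S. g (E `` {x}))" by blast
      have "c u = c v" if "(u, v) \<in> S" for u v
        using Scl[OF that] that by (auto simp: c Field_def)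
      moreover have "c \<in> Field S \<rightarrow>\<^sub>E {..<m}" using g clQ by (auto simp: c)
      ultimately show "c \<in> constant_maps (Field S) S m" by (auto simp: constant_maps_def)
    next
      fix c assume c: "c \<in> constant_maps (Field S) S m"
      define g where "g = (\<lambda>X\<in>Q. c (SOME x. x \<in> X))"
      have g: "g (E `` {x}) = c x" if x: "x \<in> Field S" for x
      proof -
        have "x \<in> E `` {x}" using equiv_class_self[OF eq x] .
        then have "(SOME y. y \<in> E `` {x}) \<in> E `` {x}" by (rule someI)
        then have "c x = c (SOME y. y \<in> E `` {x})"
          using c by (intro arc_closure_constant[of S]) (auto simp: constant_maps_def E_def)
        then show ?thesis using clQ[OF x] by (simp add: g_def)
      qed
      have "g \<in> Q \<rightarrow>\<^sub>E {..<m}"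
      proof (rule PiE_I)
        fix X assume X: "X \<in> Q"
        then obtain x where "x \<in> Field S" "X = E `` {x}" unfolding Q_def by (rule quotientE)
        then show "g X \<in> {..<m}" using g c by (auto simp: constant_maps_def)
      qed (simp add: g_def)
      moreover have "c = (\<lambda>x\<in>Field S. g (E `` {x}))"
      proof
        fix x show "c x = (\<lambda>x\<in>Field S. g (E `` {x})) x"
          using g c by (auto simp: constant_maps_def PiE_def extensional_def)
      qed
      ultimately show "c \<in> (\<lambda>g. \<lambda>x\<in>Field S. g (E `` {x})) ` (Q \<rightarrow>\<^sub>E {..<m})" by blast
    qed
  qed
  then have "card (constant_maps (Field S) S m) = card (Q \<rightarrow>\<^sub>E {..<m})"
    by (metis bij_betw_same_card)
  then show ?thesis using finQ by (simp add: card_PiE Q_def E_def arc_components_def)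
qed

text \<open>Every point of the field has a neighbour in its own class, distinct from it by
  irreflexivity. The classes partition the field, so their sizes add up.\<close>

lemma arc_components_le:
  assumes fin: "finite (Field S)" and irr: "\<And>u. (u, u) \<notin> S"
  shows "2 * arc_components S \<le> card (Field S)"
proof -
  define E where "E = (S \<union> S\<inverse>)\<^sup>+"
  define Q where "Q = Field S // E"
  have eq: "equiv (Field S) E" unfolding E_def by (rule equiv_arc_closure)
  have fX: "finite X" if "X \<in> Q" for X
  proof -
    have "X \<subseteq> Field S" using Union_quotient[OF eq] that by (auto simp: Q_def)
    then show ?thesis using fin finite_subset by blast
  qed
  have two: "2 \<le> card X" if X: "X \<in> Q" for X
  proof -
    obtain x where x: "x \<in> Field S" "X = E `` {x}" using X unfolding Q_def by (rule quotientE)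
    then obtain y where y: "(x, y) \<in> S \<union> S\<inverse>" by (auto simp: Field_def)
    then have "y \<noteq> x" using irr by auto
    moreover have "{x, y} \<subseteq> X" using equiv_class_self[OF eq x(1)] y by (auto simp: x E_def)
    ultimately show ?thesis using card_mono[OF fX[OF X], of "{x, y}"] by simp
  qed
  have "card (Field S) = card (\<Union>Q)" using Union_quotient[OF eq] by (simp add: Q_def)
  also have "\<dots> = sum card Q"
  proof (rule card_Union_disjoint)
    show "pairwise disjnt Q"
      using quotient_disj[OF eq] by (auto simp: pairwise_def disjnt_def Q_def)
  qed (rule fX)
  also have "\<dots> \<ge> (\<Sum>X\<in>Q. 2)" by (rule sum_mono) (rule two)
  finally show ?thesis by (simp add: arc_components_def Q_def E_def)
qed

lemma Field_image: "Field (map_prod h h ` S) = h ` Field S"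
  by (force simp: Field_def)

text \<open>Rather than transporting equivalence classes along \<open>h\<close>, the proof
  transports two-valued constant maps: both sides have 2 to the number of components of them, and
  powers of 2 determine the exponent.\<close>

lemma arc_components_image:
  assumes fin: "finite (Field S)" and inj: "inj_on h (Field S)"
  shows "arc_components (map_prod h h ` S) = arc_components S"
proof -
  let ?S = "map_prod h h ` S"
  let ?f = "\<lambda>c. \<lambda>x\<in>Field S. c (h x)"
  have inv: "inv_into (Field S) h (h x) = x" if "x \<in> Field S" for x
    using inj that by simp
  have F: "u \<in> Field S" "v \<in> Field S" if "(u, v) \<in> S" for u v using that by (auto simp: Field_def)
  have "bij_betw ?f (constant_maps (Field ?S) ?S 2) (constant_maps (Field S) S 2)"
  proof (rule bij_betw_byWitness[where f' = "\<lambda>c. \<lambda>y\<in>Field ?S. c (inv_into (Field S) h y)"])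
    show "\<forall>c\<in>constant_maps (Field ?S) ?S 2. (\<lambda>y\<in>Field ?S. ?f c (inv_into (Field S) h y)) = c"
    proof
      fix c :: "'b \<Rightarrow> nat" assume c: "c \<in> constant_maps (Field ?S) ?S 2"
      show "(\<lambda>y\<in>Field ?S. ?f c (inv_into (Field S) h y)) = c"
      proof
        fix y show "(\<lambda>y\<in>Field ?S. ?f c (inv_into (Field S) h y)) y = c y"
          using c inv unfolding Field_image
          by (cases "y \<in> h ` Field S") (auto simp: constant_maps_def PiE_def extensional_def Field_image)
      qed
    qed
    show "\<forall>c\<in>constant_maps (Field S) S 2. ?f (\<lambda>y\<in>Field ?S. c (inv_into (Field S) h y)) = c"
    proof
      fix c :: "'a \<Rightarrow> nat" assume c: "c \<in> constant_maps (Field S) S 2"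
      show "?f (\<lambda>y\<in>Field ?S. c (inv_into (Field S) h y)) = c"
      proof
        fix x show "?f (\<lambda>y\<in>Field ?S. c (inv_into (Field S) h y)) x = c x"
          using c inv unfolding Field_image
          by (cases "x \<in> Field S") (auto simp: constant_maps_def PiE_def extensional_def Field_image)
      qed
    qed
    show "?f ` constant_maps (Field ?S) ?S 2 \<subseteq> constant_maps (Field S) S 2"
    proof (rule image_subsetI)
      fix c :: "'b \<Rightarrow> nat" assume c: "c \<in> constant_maps (Field ?S) ?S 2"
      have "c (h u) = c (h v)" if "(u, v) \<in> S" for u v
        using c that by (force simp: constant_maps_def)
      moreover have "c (h u) \<in> {..<2}" if "u \<in> Field S" for u
        using c that by (auto simp: constant_maps_def Field_image)
      ultimately show "?f c \<in> constant_maps (Field S) S 2"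
        using F by (auto simp: constant_maps_def)
    qed
    show "(\<lambda>c. \<lambda>y\<in>Field ?S. c (inv_into (Field S) h y)) ` constant_maps (Field S) S 2
        \<subseteq> constant_maps (Field ?S) ?S 2"
    proof (rule image_subsetI)
      fix c :: "'a \<Rightarrow> nat" assume c: "c \<in> constant_maps (Field S) S 2"
      have "c u = c v" if "(u, v) \<in> S" for u v
        using c that by (auto simp: constant_maps_def)
      moreover have "c u \<in> {..<2}" if "u \<in> Field S" for u
        using c that by (auto simp: constant_maps_def)
      moreover define d where "d = (\<lambda>y\<in>Field ?S. c (inv_into (Field S) h y))"
      moreover have "d (h x) = c x" if "x \<in> Field S" for x
        using that inv by (simp add: d_def Field_image)
      moreover have "d \<in> extensional (Field ?S)" by (simp add: d_def)
      ultimately show "(\<lambda>y\<in>Field ?S. c (inv_into (Field S) h y)) \<in> constant_maps (Field ?S) ?S 2"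
        using F unfolding d_def[symmetric] by (auto simp: constant_maps_def Field_image PiE_iff)
    qed
  qed
  then have "(2::nat) ^ arc_components ?S = 2 ^ arc_components S"
    using fin by (simp add: bij_betw_same_card Field_image flip: card_constant_maps_Field)
  then show ?thesis by simp
qed

text \<open>Vertices outside \<open>Field S\<close> are unconstrained and contribute one factor
  \<open>m\<close> each; the restriction to \<open>Field S\<close> is counted by components.\<close>

lemma card_constant_maps:
  assumes fin: "finite V" and sub: "Field S \<subseteq> V"
  shows "card (constant_maps V S m) = m ^ (card V - card (Field S) + arc_components S)"
proof -
  let ?F = "Field S"
  have finF: "finite ?F" using assms finite_subset by blast
  have F: "u \<in> ?F" "v \<in> ?F" if "(u, v) \<in> S" for u v using that by (auto simp: Field_def)
  then have V: "u \<in> V" "v \<in> V" if "(u, v) \<in> S" for u v using that sub by auto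
  have "bij_betw (\<lambda>c. (restrict c (V - ?F), restrict c ?F)) (constant_maps V S m)
     ((V - ?F \<rightarrow>\<^sub>E {..<m}) \<times> constant_maps ?F S m)"
  proof (rule bij_betw_byWitness[where f' = "\<lambda>(a, b). \<lambda>x\<in>V. if x \<in> ?F then b x else a x"])
    show "\<forall>c\<in>constant_maps V S m. (case (restrict c (V - ?F), restrict c ?F) of
        (a, b) \<Rightarrow> \<lambda>x\<in>V. if x \<in> ?F then b x else a x) = c"
      using sub by (auto simp: constant_maps_def PiE_def extensional_def fun_eq_iff)
    show "\<forall>p\<in>(V - ?F \<rightarrow>\<^sub>E {..<m}) \<times> constant_maps ?F S m.
       (restrict (case p of (a, b) \<Rightarrow> \<lambda>x\<in>V. if x \<in> ?F then b x else a x) (V - ?F),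
        restrict (case p of (a, b) \<Rightarrow> \<lambda>x\<in>V. if x \<in> ?F then b x else a x) ?F) = p"
      using sub by (auto simp: constant_maps_def PiE_def extensional_def fun_eq_iff)
    show "(\<lambda>c. (restrict c (V - ?F), restrict c ?F)) ` constant_maps V S m
        \<subseteq> (V - ?F \<rightarrow>\<^sub>E {..<m}) \<times> constant_maps ?F S m"
      using sub F by (auto simp: constant_maps_def)
    show "(\<lambda>(a, b). \<lambda>x\<in>V. if x \<in> ?F then b x else a x) `
        ((V - ?F \<rightarrow>\<^sub>E {..<m}) \<times> constant_maps ?F S m) \<subseteq> constant_maps V S m"
    proof clarify
      fix a b assume a: "a \<in> V - ?F \<rightarrow>\<^sub>E {..<m}" and b: "b \<in> constant_maps ?F S m"
      have "b u = b v" if "(u, v) \<in> S" for u v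
        using b that by (auto simp: constant_maps_def)
      moreover have "b u \<in> {..<m}" if "u \<in> ?F" for u
        using b that by (auto simp: constant_maps_def)
      moreover have "a u \<in> {..<m}" if "u \<in> V - ?F" for u
        using a that by auto
      ultimately show "(\<lambda>x\<in>V. if x \<in> ?F then b x else a x) \<in> constant_maps V S m"
        using F V by (auto simp: constant_maps_def)
    qed
  qed
  then have "card (constant_maps V S m) = card (V - ?F \<rightarrow>\<^sub>E {..<m}) * card (constant_maps ?F S m)"
    by (simp add: bij_betw_same_card card_cartesian_product)
  also have "card (V - ?F \<rightarrow>\<^sub>E {..<m}) = m ^ (card V - card ?F)"
    using fin finF sub by (simp add: card_PiE card_Diff_subset)
  finally show ?thesis using card_constant_maps_Field[OF finF] by (simp add: power_add)
qed

text \<open>The indicator of a proper colouring is the product over all arcs of one minus the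
  indicator of a violation. Expanding the product over subsets of arcs and exchanging the sums gives
  the formula.\<close>

lemma card_proper_colorings:
  assumes G: "pair_graph G"
  shows "(of_nat (card (proper_colorings m G)) :: rat) =
    (\<Sum>S\<in>Pow (parcs G). (-1) ^ card S * of_nat (card (constant_maps (pverts G) S m)))"
proof -
  let ?C = "pverts G \<rightarrow>\<^sub>E {..<m}" and ?A = "parcs G"
  let ?e = "\<lambda>c (u, v). if c u = c v then 1 else 0 :: rat"
  have finC: "finite ?C" using pair_graphD(1)[OF G] by (simp add: finite_PiE)
  have finA: "finite ?A" by (rule pair_graphD(2)[OF G])
  have prod_e: "(\<Prod>a\<in>S. ?e c a) = (if \<forall>(u, v)\<in>S. c u = c v then 1 else 0)"
    if "finite S" for S and c :: "'a \<Rightarrow> nat"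
    using that by (induction S rule: finite_induct) auto
  have prod_1e: "(\<Prod>a\<in>S. 1 - ?e c a) = (if \<forall>(u, v)\<in>S. c u \<noteq> c v then 1 else 0)"
    if "finite S" for S and c :: "'a \<Rightarrow> nat"
    using that by (induction S rule: finite_induct) auto
  have "(of_nat (card (proper_colorings m G)) :: rat) =
      (\<Sum>c\<in>?C. if \<forall>(u, v)\<in>?A. c u \<noteq> c v then 1 else 0)"
    using finC by (simp add: proper_colorings_def sum.If_cases Int_def)
  also have "\<dots> = (\<Sum>c\<in>?C. \<Prod>a\<in>?A. 1 - ?e c a)"
    using prod_1e[OF finA] by simp
  also have "\<dots> = (\<Sum>c\<in>?C. \<Sum>S\<in>Pow ?A. (-1) ^ card S * (\<Prod>a\<in>S. ?e c a))"
    by (simp add: prod_diff_conv_sum[OF finA])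
  also have "\<dots> = (\<Sum>S\<in>Pow ?A. \<Sum>c\<in>?C. (-1) ^ card S * (\<Prod>a\<in>S. ?e c a))"
    by (rule sum.swap)
  also have "\<dots> = (\<Sum>S\<in>Pow ?A. (-1) ^ card S * of_nat (card (constant_maps (pverts G) S m)))"
  proof (rule sum.cong)
    fix S assume "S \<in> Pow ?A"
    then have "finite S" using finA finite_subset by blast
    have "(\<Sum>c\<in>?C. (-1) ^ card S * (\<Prod>a\<in>S. ?e c a)) =
        (-1) ^ card S * (\<Sum>c\<in>?C. if \<forall>(u, v)\<in>S. c u = c v then 1 else 0)"
      by (simp add: prod_e[OF \<open>finite S\<close>] sum_distrib_left)
    also have "(\<Sum>c\<in>?C. if \<forall>(u, v)\<in>S. c u = c v then 1 else 0 :: rat) =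
        of_nat (card (constant_maps (pverts G) S m))"
      using finC by (simp add: constant_maps_def sum.If_cases Int_def)
    finally show "(\<Sum>c\<in>?C. (-1) ^ card S * (\<Prod>a\<in>S. ?e c a)) =
        (-1) ^ card S * of_nat (card (constant_maps (pverts G) S m))" .
  qed simp
  finally show ?thesis .
qed

text \<open>A nonzero difference would have infinitely many roots. This supplies the uniqueness
  behind the definite description in \<open>chromatic_poly\<close>.\<close>

lemma poly_eq_of_nat_imp_eq:
  fixes p q :: "rat poly"
  assumes "\<And>m :: nat. poly p (of_nat m) = poly q (of_nat m)"
  shows "p = q"
proof (rule ccontr)
  assume "p \<noteq> q"
  then have "finite {x. poly (p - q) x = 0}" by (intro poly_roots_finite) simp
  moreover have "range (of_nat :: nat \<Rightarrow> rat) \<subseteq> {x. poly (p - q) x = 0}" using assms by auto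
  ultimately have "finite (range (of_nat :: nat \<Rightarrow> rat))" by (rule rev_finite_subset)
  then show False using finite_imageD[of "of_nat :: nat \<Rightarrow> rat" UNIV] by (simp add: inj_on_def)
qed

section \<open>Coefficients of the chromatic polynomial as sums over arc sets\<close>

lemma Field_subset_pverts:
  "pair_graph G \<Longrightarrow> S \<subseteq> parcs G \<Longrightarrow> Field S \<subseteq> pverts G"
  using pair_graphD(3)[of G] by (fastforce simp: Field_def)

lemma arc_components_le_graph:
  assumes G: "pair_graph G" and S: "S \<subseteq> parcs G"
  shows "2 * arc_components S \<le> card (Field S)"
proof (rule arc_components_le)
  show "finite (Field S)"
    using Field_subset_pverts[OF assms] pair_graphD(1)[OF G] finite_subset by blast
qed (use S pair_graphD(5)[OF G] in blast)

lemma chromatic_poly_conv_sum: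
  assumes G: "pair_graph G"
  shows "chromatic_poly G =
    (\<Sum>S\<in>Pow (parcs G). monom ((-1) ^ card S)
       (card (pverts G) - card (Field S) + arc_components S))" (is "_ = ?p")
  unfolding chromatic_poly_def
proof (rule the_equality)
  have "poly ?p (of_nat m) = of_nat (card (proper_colorings m G))" for m
    unfolding card_proper_colorings[OF G] poly_sum
  proof (rule sum.cong)
    fix S assume "S \<in> Pow (parcs G)"
    then have "Field S \<subseteq> pverts G" using Field_subset_pverts[OF G] by simp
    then show "poly (monom ((-1) ^ card S) (card (pverts G) - card (Field S) + arc_components S))
        (of_nat m) = (-1) ^ card S * (of_nat (card (constant_maps (pverts G) S m)) :: rat)"
      using pair_graphD(1)[OF G] by (simp add: card_constant_maps poly_monom)
  qed simp
  then show *: "\<forall>m. poly ?p (of_nat m) = of_nat (card (proper_colorings m G))" by simp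
  show "p = ?p" if "\<forall>m. poly p (of_nat m) = of_nat (card (proper_colorings m G))" for p
    by (rule poly_eq_of_nat_imp_eq) (use that * in simp)
qed

lemma
  assumes G: "pair_graph G"
  shows codeg_coeff_chromatic_poly: "codeg_coeff (card (pverts G)) (chromatic_poly G) r =
      (\<Sum>S | S \<subseteq> parcs G \<and> arc_components S + r = card (Field S). (-1) ^ card S)"
    and degree_chromatic_poly: "degree (chromatic_poly G) = card (pverts G)"
    and chromatic_poly_nonzero: "chromatic_poly G \<noteq> 0"
proof -
  let ?v = "card (pverts G)"
  have finA: "finite (parcs G)" by (rule pair_graphD(2)[OF G])
  have F: "card (Field S) \<le> ?v" "2 * arc_components S \<le> card (Field S)" if "S \<subseteq> parcs G" for S
    using Field_subset_pverts[OF G that] arc_components_le_graph[OF G that] pair_graphD(1)[OF G]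
    by (auto intro: card_mono)
  have le: "?v - card (Field S) + arc_components S \<le> ?v" if "S \<subseteq> parcs G" for S
    using F[OF that] by linarith
  show codeg: "codeg_coeff ?v (chromatic_poly G) r =
      (\<Sum>S | S \<subseteq> parcs G \<and> arc_components S + r = card (Field S). (-1) ^ card S)" for r
  proof (cases "r \<le> ?v")
    case True
    have "codeg_coeff ?v (chromatic_poly G) r = (\<Sum>S\<in>Pow (parcs G).
        if ?v - card (Field S) + arc_components S = ?v - r then (-1) ^ card S else 0)"
      using True by (simp add: codeg_coeff_def chromatic_poly_conv_sum[OF G] coeff_sum coeff_monom)
    also have "\<dots> = (\<Sum>S\<in>Pow (parcs G).
        if arc_components S + r = card (Field S) then (-1) ^ card S else 0)"
    proof (rule sum.cong)
      fix S assume "S \<in> Pow (parcs G)"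
      \<comment> \<open>Both subtractions are exact here, since \<open>card (Field S)\<close> and
        \<open>r\<close> are at most \<open>?v\<close>.\<close>
      then have "?v - card (Field S) + arc_components S = ?v - r \<longleftrightarrow>
          arc_components S + r = card (Field S)"
        using F[of S] True by auto
      then show "(if ?v - card (Field S) + arc_components S = ?v - r then (-1) ^ card S else 0) =
          (if arc_components S + r = card (Field S) then (-1) ^ card S else 0 :: rat)" by simp
    qed simp
    also have "\<dots> = (\<Sum>S | S \<subseteq> parcs G \<and> arc_components S + r = card (Field S). (-1) ^ card S)"
      using finA sum.inter_filter[of "Pow (parcs G)" "\<lambda>S. (-1) ^ card S :: rat"
          "\<lambda>S. arc_components S + r = card (Field S)"] by simp
    finally show ?thesis .
  next
    case False
    \<comment> \<open>Beyond the degree the coefficient is zero by convention, and the sum is empty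
      because \<open>r\<close> would be at most \<open>card (Field S)\<close>, hence at most
      \<open>?v\<close>.\<close>
    have none: "{S. S \<subseteq> parcs G \<and> arc_components S + r = card (Field S)} = {}"
    proof (rule equals0I)
      fix S assume "S \<in> {S. S \<subseteq> parcs G \<and> arc_components S + r = card (Field S)}"
      then show False using F(1)[of S] False by simp
    qed
    show ?thesis unfolding none using False by (simp add: codeg_coeff_def)
  qed
  \<comment> \<open>In codegree 0 the number of components equals the size of the field and is at
    most half of it, so only the empty arc set remains. The leading coefficient is therefore
    1.\<close>
  have "{S. S \<subseteq> parcs G \<and> arc_components S + 0 = card (Field S)} = {{}}"
  proof -
    have "S = {}" if S: "S \<subseteq> parcs G" "arc_components S + 0 = card (Field S)" for S
    proof -
      have "card (Field S) = 0" using F[OF S(1)] S(2) by simp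
      moreover have "finite (Field S)"
        using Field_subset_pverts[OF G S(1)] pair_graphD(1)[OF G] finite_subset by blast
      ultimately show ?thesis by (auto simp: Field_def)
    qed
    then show ?thesis by (auto simp: arc_components_def)
  qed
  then have 1: "coeff (chromatic_poly G) ?v = 1"
    using codeg[of 0] by (simp add: codeg_coeff_def)
  moreover have "degree (chromatic_poly G) \<le> ?v"
    unfolding chromatic_poly_conv_sum[OF G]
  proof (rule degree_sum_le)
    fix S assume "S \<in> Pow (parcs G)"
    then show "degree (monom ((-1) ^ card S :: rat) (?v - card (Field S) + arc_components S)) \<le> ?v"
      using le[of S] degree_monom_le order_trans by blast
  qed (use finA in simp)
  moreover have "?v \<le> degree (chromatic_poly G)" by (rule le_degree) (simp add: 1)
  ultimately show "degree (chromatic_poly G) = ?v" by simp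
  show "chromatic_poly G \<noteq> 0" using 1 by auto
qed

section \<open>Regrouping arc sets by the vertices they cover\<close>

definition spanning_weight :: "nat \<Rightarrow> 'a set \<Rightarrow> ('a \<times> 'a) set \<Rightarrow> rat" where
  "spanning_weight r U A =
     (\<Sum>S | S \<subseteq> A \<and> Field S = U \<and> arc_components S + r = card U. (-1) ^ card S)"

text \<open>This is the isomorphism invariance required by
  \<open>polynomial_seq_sum_subsets\<close>: relabelling arc sets by \<open>h\<close> preserves
  cardinality, spanning and the number of components.\<close>

lemma spanning_weight_image:
  assumes fin: "finite I" and inj: "inj_on h I"
  shows "spanning_weight r (h ` I) A = spanning_weight r I (pulled_arcs I h A)"
proof -
  let ?T = "{S. S \<subseteq> pulled_arcs I h A \<and> Field S = I \<and> arc_components S + r = card I}"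
  let ?T' = "{S. S \<subseteq> A \<and> Field S = h ` I \<and> arc_components S + r = card (h ` I)}"
  have inj2: "inj_on (map_prod h h) (I \<times> I)" using inj by (rule map_prod_inj_on) (rule inj)
  have inj3: "inj_on (\<lambda>S. map_prod h h ` S) (Pow (I \<times> I))" by (rule inj_on_image_Pow[OF inj2])
  have sub: "pulled_arcs I h A \<subseteq> I \<times> I" by (auto simp: pulled_arcs_def)
  have comp: "arc_components (map_prod h h ` S) = arc_components S" if "Field S = I" for S
    by (rule arc_components_image) (use that fin inj in simp_all)
  have cardI: "card (h ` I) = card I" using inj by (rule card_image)
  have "(\<lambda>S. map_prod h h ` S) ` ?T = ?T'"
  proof (intro equalityI subsetI)
    fix S' assume "S' \<in> (\<lambda>S. map_prod h h ` S) ` ?T"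
    then obtain S where S: "S \<in> ?T" "S' = map_prod h h ` S" by blast
    then have "S \<subseteq> pulled_arcs I h A" by simp
    then have "S' \<subseteq> A" unfolding S(2) pulled_arcs_def by auto
    then show "S' \<in> ?T'" using S comp cardI by (simp add: Field_image)
  next
    fix S' assume S': "S' \<in> ?T'"
    define S where "S = pulled_arcs I h S'"
    have "S' \<subseteq> Field S' \<times> Field S'" by (auto simp: Field_def)
    then have "S' \<subseteq> h ` I \<times> h ` I" using S' by simp
    then have img: "map_prod h h ` S = S'" unfolding S_def pulled_arcs_def by force
    have "S \<subseteq> pulled_arcs I h A" using S' unfolding S_def pulled_arcs_def by blast
    moreover have FS: "Field S = I"
    proof -
      have "h ` Field S = h ` I" using S' img Field_image[of h S] by simp
      moreover have "Field S \<subseteq> I" by (auto simp: S_def pulled_arcs_def Field_def)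
      ultimately show ?thesis using inj inj_on_image_eq_iff by blast
    qed
    ultimately have "S \<in> ?T" using S' comp[OF FS] cardI img by simp
    then show "S' \<in> (\<lambda>S. map_prod h h ` S) ` ?T" using img by blast
  qed
  moreover have "inj_on (\<lambda>S. map_prod h h ` S) ?T"
  proof (rule inj_on_subset[OF inj3])
    show "?T \<subseteq> Pow (I \<times> I)" using sub by blast
  qed
  moreover have "card (map_prod h h ` S) = card S" if "S \<in> ?T" for S
  proof (rule card_image, rule inj_on_subset[OF inj2])
    show "S \<subseteq> I \<times> I" using that sub by blast
  qed
  ultimately show ?thesis
    unfolding spanning_weight_def by (intro sum.reindex_cong[of "\<lambda>S. map_prod h h ` S"]) simp_all
qed

lemma codeg_coeff_chromatic_poly_conv_subsets:
  assumes G: "pair_graph G"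
  shows "codeg_coeff (card (pverts G)) (chromatic_poly G) r =
    (\<Sum>k\<le>2 * r. \<Sum>U | U \<subseteq> pverts G \<and> card U = k. spanning_weight r U (parcs G))"
proof -
  let ?P = "{S. S \<subseteq> parcs G \<and> arc_components S + r = card (Field S)}"
  let ?T = "{U. U \<subseteq> pverts G \<and> card U \<le> 2 * r}"
  have fV: "finite (pverts G)" by (rule pair_graphD(1)[OF G])
  have finP: "finite ?P" using pair_graphD(2)[OF G] by simp
  have finT: "finite ?T" using fV by simp
  have "Field ` ?P \<subseteq> ?T"
  proof (rule image_subsetI)
    fix S assume "S \<in> ?P"
    then have "Field S \<subseteq> pverts G" and "arc_components S + r = card (Field S)"
      and "2 * arc_components S \<le> card (Field S)"
      using Field_subset_pverts[OF G] arc_components_le_graph[OF G] by auto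
    \<comment> \<open>With c components on u vertices, c + r = u and 2c \<le> u give u \<le> 2r.
      This bound does not depend on the graph.\<close>
    then show "Field S \<in> ?T" by simp
  qed
  then have "(\<Sum>S\<in>?P. (-1) ^ card S :: rat) =
      (\<Sum>U\<in>?T. \<Sum>S | S \<in> ?P \<and> Field S = U. (-1) ^ card S)"
    by (rule sum.group[OF finP finT, symmetric])
  also have "\<dots> = (\<Sum>U\<in>?T. spanning_weight r U (parcs G))"
    unfolding spanning_weight_def by (intro sum.cong) auto
  also have "\<dots> = (\<Sum>k\<le>2 * r. \<Sum>U | U \<in> ?T \<and> card U = k. spanning_weight r U (parcs G))"
    by (rule sum.group[OF finT, symmetric]) auto
  also have "\<dots> = (\<Sum>k\<le>2 * r. \<Sum>U | U \<subseteq> pverts G \<and> card U = k. spanning_weight r U (parcs G))"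
    by (intro sum.cong) auto
  finally show ?thesis by (simp only: codeg_coeff_chromatic_poly[OF G])
qed

context strongly_polynomial_graphs
begin

lemma polynomial_seq_codeg_coeff_chromatic_poly:
  "polynomial_seq (\<lambda>n. codeg_coeff (card (pverts (G n))) (chromatic_poly (G n)) r)"
  unfolding codeg_coeff_chromatic_poly_conv_subsets[OF graph]
proof (intro polynomial_seq_sum polynomial_seq_sum_subsets)
  fix k n and h :: "nat \<Rightarrow> 'a"
  assume "inj_on h {..<k}"
  then show "spanning_weight r (h ` {..<k}) (parcs (G n)) =
      spanning_weight r {..<k} (pulled_arcs {..<k} h (parcs (G n)))"
    by (intro spanning_weight_image) simp_all
qed

end

section \<open>The characteristic polynomial\<close>

text \<open>
  Loops are absent, so the diagonal of the adjacency matrix vanishes and a permutation in the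
  Leibniz expansion picks a factor \<open>x\<close> exactly at its fixed points. Hence the coefficients
  are sums over the supports of permutations.
\<close>

definition permutation_weight :: "'a set \<Rightarrow> ('a \<times> 'a) set \<Rightarrow> rat" where
  "permutation_weight U A =
     (\<Sum>p | p permutes U \<and> (\<forall>i\<in>U. (i, p i) \<in> A). (-1) ^ card U * of_int (sign p))"

text \<open>Conjugation by \<open>h\<close> matches the permutations of \<open>I\<close> with those
  of its image and preserves the sign; its inverse is conjugation by
  \<open>inv_into I h\<close>.\<close>

lemma permutation_weight_image:
  assumes fin: "finite I" and inj: "inj_on h I"
  shows "permutation_weight (h ` I) A = permutation_weight I (pulled_arcs I h A)"
proof -
  have bij: "bij_betw h I (h ` I)" using inj by (simp add: bij_betw_def)
  have bij': "bij_betw (inv_into I h) (h ` I) I" using bij by (rule bij_betw_inv_into)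
  have inv: "inv_into I h (h x) = x" if "x \<in> I" for x using inj that by simp
  have arcs: "(\<forall>i\<in>h ` I. (i, map_permutation I h p i) \<in> A) \<longleftrightarrow> (\<forall>i\<in>I. (i, p i) \<in> pulled_arcs I h A)"
    if "p permutes I" for p
    using that by (auto simp: pulled_arcs_def map_permutation_apply[OF inj] permutes_in_image)
  have right: "map_permutation I h (map_permutation (h ` I) (inv_into I h) q) = q"
    if "q permutes h ` I" for q
    by (rule map_permutation_compose_inv[OF bij' that]) (auto simp: f_inv_into_f)
  have perm': "map_permutation (h ` I) (inv_into I h) q permutes I" if "q permutes h ` I" for q
    by (rule map_permutation_permutes[OF bij' that])
  show ?thesis
    unfolding permutation_weight_def
  proof (rule sum.reindex_bij_witness[where i = "map_permutation I h"
        and j = "map_permutation (h ` I) (inv_into I h)"], goal_cases)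
    case (1 q)
    then show ?case using right by simp
  next
    case (2 q)
    then have q: "q permutes h ` I" by simp
    show ?case using 2 arcs[OF perm'[OF q]] right[OF q] perm'[OF q] by simp
  next
    case (3 p)
    then show ?case by (intro map_permutation_compose_inv[OF bij]) (use inv in auto)
  next
    case (4 p)
    then show ?case using arcs map_permutation_permutes[OF bij] by simp
  next
    case (5 q)
    then have "sign (map_permutation I h (map_permutation (h ` I) (inv_into I h) q)) =
        sign (map_permutation (h ` I) (inv_into I h) q)"
      by (intro sign_map_permutation[OF inj _ fin]) (use perm' in simp)
    then show ?case using 5 right inj by (simp add: card_image)
  qed
qed

definition index_arcs :: "'a list \<Rightarrow> 'a pair_pre_digraph \<Rightarrow> (nat \<times> nat) set" where
  "index_arcs vs G = pulled_arcs {..<length vs} ((!) vs) (parcs G)"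

lemma char_poly_adjacency_mat:
  assumes G: "pair_graph G"
  shows "char_poly (adjacency_mat vs G) =
    (\<Sum>p | p permutes {..<length vs}. monom
       (if \<forall>i\<in>{i. p i \<noteq> i}. (i, p i) \<in> index_arcs vs G
        then (-1) ^ card {i. p i \<noteq> i} * of_int (sign p) else 0)
       (length vs - card {i. p i \<noteq> i}))"
proof -
  let ?A = "adjacency_mat vs G" and ?N = "length vs" and ?E = "index_arcs vs G"
  have carr: "?A \<in> carrier_mat ?N ?N" by (simp add: adjacency_mat_def)
  \<comment> \<open>These are the entries of xI - A: the diagonal is exactly x because there are no
    loops, and an arc contributes -1, the source of the power of -1 in the weight.\<close>
  have entry: "char_poly_matrix ?A $$ (i, j) =
      (if i = j then monom 1 1 else [:if (i, j) \<in> ?E then - 1 else 0:])" if "i < ?N" "j < ?N" for i j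
    using that pair_graphD(5)[OF G]
    by (auto simp: char_poly_matrix_def adjacency_mat_def index_arcs_def pulled_arcs_def x_as_monom)
  have "of_int (sign p) * (\<Prod>i = 0..<?N. char_poly_matrix ?A $$ (i, p i)) =
      monom (if \<forall>i\<in>{i. p i \<noteq> i}. (i, p i) \<in> ?E
        then (-1) ^ card {i. p i \<noteq> i} * of_int (sign p) else 0) (?N - card {i. p i \<noteq> i})"
    if p: "p permutes {..<?N}" for p
  proof -
    define U where "U = {i. p i \<noteq> i}"
    have U: "U \<subseteq> {..<?N}" using p unfolding U_def permutes_def by auto
    then have finU: "finite U" using finite_subset by blast
    have pN: "p i < ?N" if "i < ?N" for i using permutes_in_image[OF p, of i] that by simp
    have prodU: "(\<Prod>i\<in>T. [:if (i, p i) \<in> ?E then - 1 else 0:]) =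
        [:if \<forall>i\<in>T. (i, p i) \<in> ?E then (-1) ^ card T else 0 :: rat:]" if "finite T" for T
      using that by (induction T rule: finite_induct) auto
    have "(\<Prod>i = 0..<?N. char_poly_matrix ?A $$ (i, p i)) =
        (\<Prod>i\<in>{..<?N}. if p i = i then monom 1 1 else [:if (i, p i) \<in> ?E then - 1 else 0:])"
      by (intro prod.cong) (auto simp: entry pN)
    also have "\<dots> = (\<Prod>i\<in>{..<?N} - U. monom 1 1) * (\<Prod>i\<in>U. [:if (i, p i) \<in> ?E then - 1 else 0:])"
      unfolding prod.subset_diff[OF U finite_lessThan]
      by (intro arg_cong2[where f = "(*)"] prod.cong) (auto simp: U_def)
    also have "\<dots> = monom 1 (?N - card U) * [:if \<forall>i\<in>U. (i, p i) \<in> ?E then (-1) ^ card U else 0:]"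
      using U finU by (simp add: prodU card_Diff_subset monom_power)
    also have "of_int (sign p) * \<dots> = monom (if \<forall>i\<in>U. (i, p i) \<in> ?E
        then (-1) ^ card U * of_int (sign p) else 0) (?N - card U)"
      by (simp add: of_int_poly smult_monom mult.commute)
    finally show ?thesis by (simp only: U_def)
  qed
  then show ?thesis
    unfolding char_poly_def det_def'[OF char_poly_matrix_closed[OF carr]]
    by (intro sum.cong) (auto simp: atLeast0LessThan)
qed

lemma codeg_coeff_char_poly_adjacency_mat:
  assumes G: "pair_graph G"
  shows "codeg_coeff (length vs) (char_poly (adjacency_mat vs G)) r =
    (\<Sum>U | U \<subseteq> {..<length vs} \<and> card U = r. permutation_weight U (index_arcs vs G))"
proof -
  let ?N = "length vs" and ?E = "index_arcs vs G"
  let ?supp = "\<lambda>p :: nat \<Rightarrow> nat. {i. p i \<noteq> i}"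
  let ?w = "\<lambda>p. if \<forall>i\<in>?supp p. (i, p i) \<in> ?E then (-1) ^ card (?supp p) * of_int (sign p) else 0 :: rat"
  let ?P = "{p. p permutes {..<?N}}" and ?T = "{U. U \<subseteq> {..<?N} \<and> card U = r}"
  have finP: "finite ?P" by (simp add: finite_permutations)
  have supp: "?supp p \<subseteq> {..<?N}" if "p permutes {..<?N}" for p
    using that by (auto simp: permutes_def)
  have supp_le: "card (?supp p) \<le> ?N" if "p permutes {..<?N}" for p
    using card_mono[OF finite_lessThan supp[OF that]] by simp
  have irr: "(i, i) \<notin> ?E" for i
    using pair_graphD(5)[OF G] by (auto simp: index_arcs_def pulled_arcs_def)
  have "codeg_coeff ?N (char_poly (adjacency_mat vs G)) r =
      (\<Sum>p\<in>?P. if card (?supp p) = r then ?w p else 0)"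
  proof (cases "r \<le> ?N")
    case True
    then have "codeg_coeff ?N (char_poly (adjacency_mat vs G)) r =
      (\<Sum>p\<in>?P. if ?N - card (?supp p) = ?N - r then ?w p else 0)"
      by (simp only: codeg_coeff_def char_poly_adjacency_mat[OF G] coeff_sum coeff_monom if_True)
    also have "\<dots> = (\<Sum>p\<in>?P. if card (?supp p) = r then ?w p else 0)"
    proof (rule sum.cong)
      fix p assume "p \<in> ?P"
      then have "?N - card (?supp p) = ?N - r \<longleftrightarrow> card (?supp p) = r"
        using supp_le[of p] True by auto
      then show "(if ?N - card (?supp p) = ?N - r then ?w p else 0) =
          (if card (?supp p) = r then ?w p else 0)" by simp
    qed simp
    finally show ?thesis .
  next
    case False
    \<comment> \<open>A support has at most \<open>?N\<close> elements, so the sum vanishes beyond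
      the degree, in agreement with the convention in \<open>codeg_coeff\<close>.\<close>
    have "(\<Sum>p\<in>?P. if card (?supp p) = r then ?w p else 0) = 0"
    proof (rule sum.neutral, rule ballI)
      fix p assume "p \<in> ?P"
      then have "card (?supp p) \<noteq> r" using supp_le[of p] False by auto
      then show "(if card (?supp p) = r then ?w p else 0) = 0" by simp
    qed
    then show ?thesis using False by (simp only: codeg_coeff_def if_False)
  qed
  also have "\<dots> = (\<Sum>p | p \<in> ?P \<and> card (?supp p) = r. ?w p)"
    by (rule sum.inter_filter[OF finP, symmetric])
  also have "\<dots> = (\<Sum>U\<in>?T. \<Sum>p | p \<in> {p. p \<in> ?P \<and> card (?supp p) = r} \<and> ?supp p = U. ?w p)"
  proof (rule sum.group[symmetric])
    show "?supp ` {p. p \<in> ?P \<and> card (?supp p) = r} \<subseteq> ?T"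
    proof (rule image_subsetI)
      fix p assume "p \<in> {p. p \<in> ?P \<and> card (?supp p) = r}"
      then show "?supp p \<in> ?T" using supp[of p] by blast
    qed
  qed (use finP in simp_all)
  also have "\<dots> = (\<Sum>U\<in>?T. permutation_weight U ?E)"
  proof (rule sum.cong)
    fix U assume U: "U \<in> ?T"
    have iff: "p \<in> {p. p \<in> ?P \<and> card (?supp p) = r} \<and> ?supp p = U \<and> (\<forall>i\<in>U. (i, p i) \<in> ?E) \<longleftrightarrow>
        p permutes U \<and> (\<forall>i\<in>U. (i, p i) \<in> ?E)" for p
    proof (intro iffI conjI; elim conjE)
      assume "p \<in> {p. p \<in> ?P \<and> card (?supp p) = r}" "?supp p = U"
      then show "p permutes U" by (auto intro: permutes_superset)
    next
      \<comment> \<open>A fixed point of \<open>p\<close> in \<open>U\<close> would be a loop of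
        \<open>?E\<close>, so moving along arcs makes the support all of \<open>U\<close>.\<close>
      assume p: "p permutes U" and E: "\<forall>i\<in>U. (i, p i) \<in> ?E"
      show "?supp p = U"
        using p E irr by (auto simp: permutes_def)
      then show "p \<in> {p. p \<in> ?P \<and> card (?supp p) = r}"
        using U permutes_subset[OF p] by auto
    qed
    have "(\<Sum>p | p \<in> {p. p \<in> ?P \<and> card (?supp p) = r} \<and> ?supp p = U. ?w p) =
      (\<Sum>p | p \<in> {p. p \<in> ?P \<and> card (?supp p) = r} \<and> ?supp p = U.
         if \<forall>i\<in>U. (i, p i) \<in> ?E then (-1) ^ card U * of_int (sign p) else 0)"
      by (intro sum.cong) auto
    also have "\<dots> = (\<Sum>p | p \<in> {p. p \<in> {p. p \<in> ?P \<and> card (?supp p) = r} \<and> ?supp p = U} \<and>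
         (\<forall>i\<in>U. (i, p i) \<in> ?E). (-1) ^ card U * of_int (sign p))"
      by (rule sum.inter_filter[symmetric]) (use finP in simp)
    also have "\<dots> = permutation_weight U ?E"
      unfolding permutation_weight_def using iff by (intro sum.cong) auto
    finally show "(\<Sum>p | p \<in> {p. p \<in> ?P \<and> card (?supp p) = r} \<and> ?supp p = U. ?w p) =
        permutation_weight U ?E" .
  qed simp
  finally show ?thesis .
qed

section \<open>Isomorphic copies on initial segments of the naturals\<close>

text \<open>Names the very choice made inside \<open>graph_char_poly\<close>, so that matrix and
  relabelled graph use the same enumeration.\<close>

definition vertex_enum :: "'a pair_pre_digraph \<Rightarrow> 'a list" where
  "vertex_enum G = (SOME vs. distinct vs \<and> set vs = pverts G)"

definition index_graph :: "'a pair_pre_digraph \<Rightarrow> nat pair_pre_digraph" where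
  "index_graph G = \<lparr>pverts = {..<length (vertex_enum G)}, parcs = index_arcs (vertex_enum G) G\<rparr>"

lemma
  assumes "pair_graph G"
  shows distinct_vertex_enum: "distinct (vertex_enum G)"
    and set_vertex_enum: "set (vertex_enum G) = pverts G"
    and length_vertex_enum: "length (vertex_enum G) = card (pverts G)"
proof -
  obtain vs where "distinct vs \<and> set vs = pverts G"
    using finite_distinct_list[OF pair_graphD(1)[OF assms]] by blast
  then have "distinct (vertex_enum G) \<and> set (vertex_enum G) = pverts G"
    unfolding vertex_enum_def by (rule someI)
  then show "distinct (vertex_enum G)" "set (vertex_enum G) = pverts G"
      "length (vertex_enum G) = card (pverts G)"
    using distinct_card by metis+
qed

lemma pair_graph_index_graph:
  assumes "pair_graph G"
  shows "pair_graph (index_graph G)"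
  by (rule pair_graphI)
    (use pair_graphD(4,5)[OF assms] in \<open>auto simp: index_graph_def index_arcs_def pulled_arcs_def\<close>)

text \<open>Composition with the enumeration, a bijection from positions to vertices that preserves
  and reflects arcs, is a bijection between the two sets of homomorphisms.\<close>

lemma hom_count_index_graph:
  assumes G: "pair_graph G" and F: "pair_graph F"
  shows "hom_count F (index_graph G) = hom_count F G"
proof -
  let ?vs = "vertex_enum G" and ?I = "{..<length (vertex_enum G)}"
  have bij: "bij_betw ((!) ?vs) ?I (pverts G)"
    using bij_betw_nth[OF distinct_vertex_enum[OF G] refl set_vertex_enum[OF G, symmetric]] .
  let ?g = "inv_into ?I ((!) ?vs)"
  have g: "?g v \<in> ?I" "?vs ! ?g v = v" if "v \<in> pverts G" for v
    using bij_betw_inv_into_right[OF bij that] bij_betw_apply[OF bij_betw_inv_into[OF bij] that] by auto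
  have g': "?g (?vs ! i) = i" if "i \<in> ?I" for i using bij_betw_inv_into_left[OF bij that] .
  have nth: "?vs ! i \<in> pverts G" if "i \<in> ?I" for i using bij_betw_apply[OF bij that] .
  have arc: "(i, j) \<in> index_arcs ?vs G \<longleftrightarrow> (?vs ! i, ?vs ! j) \<in> parcs G" if "i \<in> ?I" "j \<in> ?I" for i j
    using that by (simp add: index_arcs_def pulled_arcs_def)
  have FV: "u \<in> pverts F" "v \<in> pverts F" if "(u, v) \<in> parcs F" for u v
    using pair_graphD(3)[OF F] that by auto
  have "bij_betw (\<lambda>h. \<lambda>x\<in>pverts F. ?vs ! h x) (graph_homs F (index_graph G)) (graph_homs F G)"
  proof (rule bij_betw_byWitness[where f' = "\<lambda>h. \<lambda>x\<in>pverts F. ?g (h x)"])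
    show "\<forall>h\<in>graph_homs F (index_graph G). (\<lambda>x\<in>pverts F. ?g ((\<lambda>x\<in>pverts F. ?vs ! h x) x)) = h"
    proof
      fix h assume "h \<in> graph_homs F (index_graph G)"
      then have h: "h \<in> pverts F \<rightarrow>\<^sub>E ?I" by (simp add: graph_homs_def index_graph_def)
      show "(\<lambda>x\<in>pverts F. ?g ((\<lambda>x\<in>pverts F. ?vs ! h x) x)) = h"
      proof
        fix x show "(\<lambda>x\<in>pverts F. ?g ((\<lambda>x\<in>pverts F. ?vs ! h x) x)) x = h x"
          using h g'[of "h x"] by (cases "x \<in> pverts F") (auto simp: PiE_iff extensional_def)
      qed
    qed
    show "\<forall>h\<in>graph_homs F G. (\<lambda>x\<in>pverts F. ?vs ! ((\<lambda>x\<in>pverts F. ?g (h x)) x)) = h"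
    proof
      fix h assume "h \<in> graph_homs F G"
      then have h: "h \<in> pverts F \<rightarrow>\<^sub>E pverts G" by (simp add: graph_homs_def)
      show "(\<lambda>x\<in>pverts F. ?vs ! ((\<lambda>x\<in>pverts F. ?g (h x)) x)) = h"
      proof
        fix x show "(\<lambda>x\<in>pverts F. ?vs ! ((\<lambda>x\<in>pverts F. ?g (h x)) x)) x = h x"
          using h g(2)[of "h x"] by (cases "x \<in> pverts F") (auto simp: PiE_iff extensional_def)
      qed
    qed
    show "(\<lambda>h. \<lambda>x\<in>pverts F. ?vs ! h x) ` graph_homs F (index_graph G) \<subseteq> graph_homs F G"
    proof (rule image_subsetI)
      fix h assume hh: "h \<in> graph_homs F (index_graph G)"
      then have h: "h x \<in> ?I" if "x \<in> pverts F" for x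
        using that by (auto simp: graph_homs_def index_graph_def)
      have "(?vs ! h u, ?vs ! h v) \<in> parcs G" if "(u, v) \<in> parcs F" for u v
        using that hh arc[OF h[OF FV(1)[OF that]] h[OF FV(2)[OF that]]]
        by (auto simp: graph_homs_def index_graph_def)
      then show "(\<lambda>x\<in>pverts F. ?vs ! h x) \<in> graph_homs F G"
        unfolding graph_homs_def using nth[OF h] FV by auto
    qed
    show "(\<lambda>h. \<lambda>x\<in>pverts F. ?g (h x)) ` graph_homs F G \<subseteq> graph_homs F (index_graph G)"
    proof (rule image_subsetI)
      fix h assume hh: "h \<in> graph_homs F G"
      then have h: "h x \<in> pverts G" if "x \<in> pverts F" for x
        using that by (auto simp: graph_homs_def)
      have "(?g (h u), ?g (h v)) \<in> index_arcs ?vs G" if "(u, v) \<in> parcs F" for u v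
      proof -
        have "(h u, h v) \<in> parcs G" using that hh by (auto simp: graph_homs_def)
        then show ?thesis
          using arc[OF g(1)[OF h[OF FV(1)[OF that]]] g(1)[OF h[OF FV(2)[OF that]]]]
            g(2)[OF h[OF FV(1)[OF that]]] g(2)[OF h[OF FV(2)[OF that]]] by simp
      qed
      then show "(\<lambda>x\<in>pverts F. ?g (h x)) \<in> graph_homs F (index_graph G)"
        unfolding graph_homs_def index_graph_def using g(1)[OF h] FV by auto
    qed
  qed
  then show ?thesis unfolding hom_count_def by (rule bij_betw_same_card)
qed

lemma degree_graph_char_poly:
  assumes "pair_graph G"
  shows "degree (graph_char_poly G) = card (pverts G)" and "graph_char_poly G \<noteq> 0"
proof -
  have "adjacency_mat (vertex_enum G) G \<in> carrier_mat (card (pverts G)) (card (pverts G))"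
    by (simp add: adjacency_mat_def length_vertex_enum[OF assms])
  from degree_monic_char_poly[OF this]
  show "degree (graph_char_poly G) = card (pverts G)" "graph_char_poly G \<noteq> 0"
    by (auto simp: graph_char_poly_def vertex_enum_def)
qed

context strongly_polynomial_graphs
begin

lemma strongly_polynomial_index_graph: "strongly_polynomial_graphs (\<lambda>n. index_graph (G n))"
proof (rule strongly_polynomial_graphs.intro)
  show "strongly_polynomial (\<lambda>n. index_graph (G n))"
    using strong by (simp add: strongly_polynomial_def hom_count_index_graph[OF graph])
qed (rule pair_graph_index_graph[OF graph])

lemma polynomial_seq_codeg_coeff_graph_char_poly:
  "polynomial_seq (\<lambda>n. codeg_coeff (card (pverts (G n))) (graph_char_poly (G n)) r)"
proof -
  \<comment> \<open>The coefficient formula sums over sets of matrix indices. In the copies these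
    are sets of vertices, so the counting results apply to the copies.\<close>
  interpret ix: strongly_polynomial_graphs "\<lambda>n. index_graph (G n)"
    by (rule strongly_polynomial_index_graph)
  have "codeg_coeff (card (pverts (G n))) (graph_char_poly (G n)) r =
      (\<Sum>U | U \<subseteq> pverts (index_graph (G n)) \<and> card U = r.
         permutation_weight U (parcs (index_graph (G n))))" for n
    using codeg_coeff_char_poly_adjacency_mat[OF graph, of "vertex_enum (G n)" n r]
    by (simp add: graph_char_poly_def vertex_enum_def[symmetric] length_vertex_enum[OF graph]
        index_graph_def)
  moreover have "polynomial_seq (\<lambda>n. \<Sum>U | U \<subseteq> pverts (index_graph (G n)) \<and> card U = r.
      permutation_weight U (parcs (index_graph (G n))))"
  proof (rule ix.polynomial_seq_sum_subsets)
    fix n and h :: "nat \<Rightarrow> nat"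
    assume "inj_on h {..<r}"
    then show "permutation_weight (h ` {..<r}) (parcs (index_graph (G n))) =
        permutation_weight {..<r} (pulled_arcs {..<r} h (parcs (index_graph (G n))))"
      by (intro permutation_weight_image) simp_all
  qed
  ultimately show ?thesis by simp
qed

end

section \<open>Two-level polynomials\<close>

text \<open>\<open>D\<close> is a product of denominators of the coefficients. After scaling by
  \<open>D\<close> the polynomial has integer coefficients, so x - y divides the difference of its
  values; integrality of the values carries this through the induction.\<close>

lemma poly_common_denominator:
  fixes p :: "rat poly"
  shows "\<exists>D::int. D > 0 \<and> (\<forall>x. of_int D * poly p (of_int x) \<in> \<int>) \<and>
    (\<forall>x y. \<exists>z. of_int D * (poly p (of_int x) - poly p (of_int y)) = of_int ((x - y) * z))"
proof (induction p)
  case 0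
  show ?case by (intro exI[of _ 1]) (auto intro: exI[of _ 0])
next
  case (pCons a p)
  then obtain D :: int where D: "D > 0" and int: "\<And>x. of_int D * poly p (of_int x) \<in> \<int>"
    and diff: "\<And>x y. \<exists>z. of_int D * (poly p (of_int x) - poly p (of_int y)) = of_int ((x - y) * z)"
    by blast
  obtain b c :: int where "b > 0" and a: "a = of_int c / of_int b"
    by (metis quotient_of_div quotient_of_denom_pos surj_pair)
  have ba: "of_int b * a = of_int c" using \<open>b > 0\<close> a by simp
  show ?case
  proof (rule exI[of _ "b * D"], intro conjI allI)
    show "b * D > 0" using \<open>b > 0\<close> D by simp
  next
    fix x
    have "of_int (b * D) * poly (pCons a p) (of_int x) =
        of_int D * (of_int b * a) + of_int b * of_int x * (of_int D * poly p (of_int x))"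
      by (simp add: algebra_simps)
    then show "of_int (b * D) * poly (pCons a p) (of_int x) \<in> \<int>"
      using int[of x] by (simp add: ba)
  next
    fix x y
    obtain k where k: "of_int D * poly p (of_int y) = of_int k"
      using int[of y] by (auto elim: Ints_cases)
    obtain z where z: "of_int D * (poly p (of_int x) - poly p (of_int y)) = of_int ((x - y) * z)"
      using diff by blast
    \<comment> \<open>The constant term cancels, and x p(x) - y p(y) = x (p(x) - p(y)) + (x - y)
      p(y).\<close>
    have "of_int (b * D) * (poly (pCons a p) (of_int x) - poly (pCons a p) (of_int y)) =
        of_int b * (of_int x * (of_int D * (poly p (of_int x) - poly p (of_int y))) +
          (of_int x - of_int y) * (of_int D * poly p (of_int y)))"
      by (simp add: algebra_simps)
    also have "\<dots> = of_int ((x - y) * (b * (x * z + k)))"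
      unfolding z k by (simp add: algebra_simps)
    finally show "\<exists>z. of_int (b * D) * (poly (pCons a p) (of_int x) - poly (pCons a p) (of_int y)) =
        of_int ((x - y) * z)" by blast
  qed
qed

text \<open>
  With \<open>D\<close> a common denominator, \<open>p\<close> modulo the integers is periodic with period \<open>D\<close>, so
  its values at negative integers are controlled by those at natural numbers.
\<close>

lemma numerical_poly_if_Ints_on_Nats:
  assumes "\<And>n :: nat. poly p (of_nat n) \<in> \<int>"
  shows "numerical_poly p"
  unfolding numerical_poly_def
proof
  fix q :: int
  obtain D :: int where D: "D > 0"
    and diff: "\<And>x y. \<exists>z. of_int D * (poly p (of_int x) - poly p (of_int y)) = of_int ((x - y) * z)"
    using poly_common_denominator[of p] by blast
  \<comment> \<open>A number congruent to \<open>q\<close> modulo \<open>D\<close>, and nonnegative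
    because \<open>D\<close> is at least 1.\<close>
  define n where "n = nat (q + D * \<bar>q\<bar>)"
  have "\<bar>q\<bar> \<le> D * \<bar>q\<bar>" using D mult_right_mono[of 1 D "\<bar>q\<bar>"] by simp
  then have n: "int n = q + D * \<bar>q\<bar>" by (simp add: n_def)
  obtain z where z: "of_int D * (poly p (of_int q) - poly p (of_int (int n))) = of_int ((q - int n) * z)"
    using diff by blast
  also have "(q - int n) * z = D * (- \<bar>q\<bar> * z)" by (simp add: n)
  finally have "of_int D * (poly p (of_int q) - poly p (of_int (int n))) = of_int D * of_int (- \<bar>q\<bar> * z)"
    by (simp only: of_int_mult)
  then have "poly p (of_int q) - poly p (of_int (int n)) = of_int (- \<bar>q\<bar> * z)"
    using D by (subst (asm) mult_left_cancel) simp_all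
  then have "poly p (of_int q) = poly p (of_nat n) + of_int (- \<bar>q\<bar> * z)"
    by (simp add: algebra_simps)
  then show "poly p (of_int q) \<in> \<int>" using assms[of n] by (metis Ints_add Ints_of_int)
qed

text \<open>The degree function interpolates the naturals \<open>d n\<close>, so it is nonnegative
  at every index, the level set is everything, and the depth can be constantly infinite.\<close>

lemma two_level_poly_infinite_depthI:
  assumes d: "polynomial_seq (\<lambda>n. of_nat (d n))"
    and f: "\<And>n. f n \<noteq> 0" "\<And>n. degree (f n) = d n"
    and coeffs: "\<And>r. polynomial_seq (\<lambda>n. codeg_coeff (d n) (f n) r)"
  shows "two_level_poly_infinite_depth f"
proof -
  obtain g :: "rat poly" where g: "\<And>n. of_nat (d n) = poly g (of_nat n)"
    using d unfolding polynomial_seq_def by blast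
  have "\<forall>r. \<exists>p. \<forall>n. codeg_coeff (d n) (f n) r = poly p (of_nat n)"
    using coeffs unfolding polynomial_seq_def by blast
  then obtain \<phi> :: "nat \<Rightarrow> rat poly" where \<phi>: "\<And>r n. codeg_coeff (d n) (f n) r = poly (\<phi> r) (of_nat n)"
    by metis
  have nonneg: "0 \<le> poly g (of_nat n)" for n by (simp flip: g)
  have "numerical_poly g"
    by (rule numerical_poly_if_Ints_on_Nats) (simp flip: g)
  moreover have "\<infinity> \<in> insert (- 1) (range ereal_of_enat)"
    by (intro insertI2 range_eqI[of _ _ "\<infinity>"]) simp
  moreover have "level_set g = UNIV" using nonneg by (simp add: level_set_def)
  ultimately have "two_level_poly g (\<lambda>_. \<infinity>) f"
    unfolding two_level_poly_def using f g \<phi> nonneg by auto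
  then show ?thesis unfolding two_level_poly_infinite_depth_def by blast
qed

text \<open>Vertices are the homomorphic images of a single point, here the pattern
  \<open>{0}\<close> without arcs.\<close>

lemma (in strongly_polynomial_graphs) polynomial_seq_card_pverts:
  "polynomial_seq (\<lambda>n. of_nat (card (pverts (G n))))"
proof -
  have "card (constrained_maps {0} {} {} {} (G n)) = card (pverts (G n))" for n
    by (simp add: constrained_maps_def card_PiE)
  then show ?thesis using polynomial_seq_arc_maps[of "{0}" "{}"] by simp
qed

theorem theorem3p5:
  fixes G :: "nat \<Rightarrow> 'a pair_pre_digraph"
  assumes "\<And>n. pair_graph (G n)"
    and "strongly_polynomial G"
  shows "two_level_poly_infinite_depth (\<lambda>n. chromatic_poly (G n)) \<and>
         two_level_poly_infinite_depth (\<lambda>n. graph_char_poly (G n))"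
proof -
  interpret strongly_polynomial_graphs G by (rule strongly_polynomial_graphs.intro) (rule assms)+
  have chrom: "two_level_poly_infinite_depth (\<lambda>n. chromatic_poly (G n))"
    by (rule two_level_poly_infinite_depthI[OF polynomial_seq_card_pverts])
      (simp_all only: chromatic_poly_nonzero[OF graph] degree_chromatic_poly[OF graph]
        polynomial_seq_codeg_coeff_chromatic_poly not_False_eq_True)
  have char: "two_level_poly_infinite_depth (\<lambda>n. graph_char_poly (G n))"
    by (rule two_level_poly_infinite_depthI[OF polynomial_seq_card_pverts])
      (simp_all only: degree_graph_char_poly[OF graph]
        polynomial_seq_codeg_coeff_graph_char_poly not_False_eq_True)
  show ?thesis using chrom char by blast
qed

end
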